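(* Let $(C,\Delta_0,\alpha,R)$ be a Hom-coassociative Rota-Baxter coalgebra of weight $-1$. Define the linear map $\Delta:C\to C\otimes C$ by $$\Delta=(R\otimes I)\circ\Delta_0-\tau\circ(I\otimes R)\circ\Delta_0-\Delta_0 .$$ Then $(C,\Delta,\alpha)$ is a Hom-preLie coalgebra.
   Context: All vector spaces are over a field $\mathbb{F}$ of characteristic $0$; $I$ is the identity map and $\tau(x\otimes y)=y\otimes x$. A Hom-coassociative coalgebra $(C,\Delta,\alpha)$ is a vector space $C$ with linear maps $\Delta:C\to C\otimes C$ and $\alpha:C\to C$ such that $(\alpha\otimes\Delta)\circ\Delta=(\Delta\otimes\alpha)\circ\Delta$. A Hom-coassociative Rota-Baxter coalgebra $(C,\Delta,\alpha,R)$ of weight $\lambda\in\mathbb{F}$ is a Hom-coassociative coalgebra $(C,\Delta,\alpha)$ with a linear map $R:C\to C$ such that $R\circ\alpha=\alpha\circ R$ and $(R\otimes R)\circ\Delta=\big((R\otimes I)\circ\Delta+(I\otimes R)\circ\Delta+\lambda\Delta\big)\circ R$. A Hom-preLie coalgebra $(C,\Delta,\alpha)$ is a vector space $C$ with linear maps $\Delta:C\to C\otimes C$ and $\alpha:C\to C$ such that $(\Delta\otimes\alpha)\circ\Delta-(\alpha\otimes\Delta)\circ\Delta=(\tau\otimes I)\circ\big((\Delta\otimes\alpha)\circ\Delta-(\alpha\otimes\Delta)\circ\Delta\big)$. *)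

theory Defs
  imports "HOL-Algebra.AbelCoset" "Jordan_Normal_Form.Missing_VectorSpace"
begin

section \<open>Tensor products of vector spaces\<close>

text \<open>
  Vector spaces are those of the entry \<open>VectorSpace\<close>: records with an explicit carrier over a
  field record. The tensor product of \<open>V\<close> and \<open>W\<close> is the quotient of the free vector space on
  \<open>carrier V \<times> carrier W\<close> by the subspace spanned by the bilinearity relations. The ring fields
  \<open>mult\<close> and \<open>one\<close> that a module record inherits are irrelevant and get dummy values.
\<close>

definition free_space :: "('k, 'm) ring_scheme \<Rightarrow> 's set \<Rightarrow> ('k, 's \<Rightarrow> 'k) module"
  where "free_space K S = \<lparr>
    carrier = {u. (\<forall>s\<in>S. u s \<in> carrier K) \<and> (\<forall>s. s \<notin> S \<longrightarrow> u s = \<zero>\<^bsub>K\<^esub>) \<and>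
                  finite {s. u s \<noteq> \<zero>\<^bsub>K\<^esub>}},
    mult = (\<lambda>u v s. \<zero>\<^bsub>K\<^esub>),
    one = (\<lambda>s. \<zero>\<^bsub>K\<^esub>),
    zero = (\<lambda>s. \<zero>\<^bsub>K\<^esub>),
    add = (\<lambda>u v s. u s \<oplus>\<^bsub>K\<^esub> v s),
    smult = (\<lambda>a u s. a \<otimes>\<^bsub>K\<^esub> u s)\<rparr>"

definition free_gen :: "('k, 'm) ring_scheme \<Rightarrow> 's \<Rightarrow> 's \<Rightarrow> 'k"
  where "free_gen K s = (\<lambda>t. if t = s then \<one>\<^bsub>K\<^esub> else \<zero>\<^bsub>K\<^esub>)"

definition quotient_space :: "('k, 'v, 'n) module_scheme \<Rightarrow> 'v set \<Rightarrow> ('k, 'v set) module"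
  where "quotient_space V N = \<lparr>
    carrier = a_rcosets\<^bsub>V\<^esub> N,
    mult = (\<lambda>X Y. N),
    one = N,
    zero = N,
    add = (\<lambda>X Y. X <+>\<^bsub>V\<^esub> Y),
    smult = (\<lambda>a X. \<Union>x\<in>X. N +>\<^bsub>V\<^esub> (a \<odot>\<^bsub>V\<^esub> x))\<rparr>"

definition tensor_relations ::
  "('k, 'm) ring_scheme \<Rightarrow> ('k, 'v, 'n) module_scheme \<Rightarrow> ('k, 'w, 'p) module_scheme
    \<Rightarrow> ('v \<times> 'w \<Rightarrow> 'k) set"
  where "tensor_relations K V W =
    (let F = free_space K (carrier V \<times> carrier W) in
      {free_gen K (v \<oplus>\<^bsub>V\<^esub> v', w) \<ominus>\<^bsub>F\<^esub> (free_gen K (v, w) \<oplus>\<^bsub>F\<^esub> free_gen K (v', w)) | v v' w.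
         v \<in> carrier V \<and> v' \<in> carrier V \<and> w \<in> carrier W} \<union>
      {free_gen K (v, w \<oplus>\<^bsub>W\<^esub> w') \<ominus>\<^bsub>F\<^esub> (free_gen K (v, w) \<oplus>\<^bsub>F\<^esub> free_gen K (v, w')) | v w w'.
         v \<in> carrier V \<and> w \<in> carrier W \<and> w' \<in> carrier W} \<union>
      {free_gen K (a \<odot>\<^bsub>V\<^esub> v, w) \<ominus>\<^bsub>F\<^esub> a \<odot>\<^bsub>F\<^esub> free_gen K (v, w) | a v w.
         a \<in> carrier K \<and> v \<in> carrier V \<and> w \<in> carrier W} \<union>
      {free_gen K (v, a \<odot>\<^bsub>W\<^esub> w) \<ominus>\<^bsub>F\<^esub> a \<odot>\<^bsub>F\<^esub> free_gen K (v, w) | a v w.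
         a \<in> carrier K \<and> v \<in> carrier V \<and> w \<in> carrier W})"

definition tensor_null ::
  "('k, 'm) ring_scheme \<Rightarrow> ('k, 'v, 'n) module_scheme \<Rightarrow> ('k, 'w, 'p) module_scheme
    \<Rightarrow> ('v \<times> 'w \<Rightarrow> 'k) set"
  where "tensor_null K V W =
    module.span K (free_space K (carrier V \<times> carrier W)) (tensor_relations K V W)"

definition tensor ::
  "('k, 'm) ring_scheme \<Rightarrow> ('k, 'v, 'n) module_scheme \<Rightarrow> ('k, 'w, 'p) module_scheme
    \<Rightarrow> ('k, ('v \<times> 'w \<Rightarrow> 'k) set) module"
  where "tensor K V W =
    quotient_space (free_space K (carrier V \<times> carrier W)) (tensor_null K V W)"

text \<open>The pure tensor \<open>v \<otimes> w\<close>.\<close>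

definition pure_tensor ::
  "('k, 'm) ring_scheme \<Rightarrow> ('k, 'v, 'n) module_scheme \<Rightarrow> ('k, 'w, 'p) module_scheme
    \<Rightarrow> 'v \<Rightarrow> 'w \<Rightarrow> ('v \<times> 'w \<Rightarrow> 'k) set"
  where "pure_tensor K V W v w =
    tensor_null K V W +>\<^bsub>free_space K (carrier V \<times> carrier W)\<^esub> free_gen K (v, w)"

text \<open>
  For a bilinear map \<open>b\<close> from \<open>V \<times> W\<close> to \<open>U\<close>, the induced linear map from \<open>V \<otimes> W\<close> to \<open>U\<close>,
  computed on a representative of the coset \<open>X\<close>. By bilinearity the value does not depend on the
  representative (lemma \<open>tensor_lift_coset\<close>).
\<close>

definition tensor_lift ::
  "('k, 'm) ring_scheme \<Rightarrow> ('k, 'u, 'n) module_scheme \<Rightarrow> ('v \<Rightarrow> 'w \<Rightarrow> 'u)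
    \<Rightarrow> ('v \<times> 'w \<Rightarrow> 'k) set \<Rightarrow> 'u"
  where "tensor_lift K U b X =
    (let u = SOME u. u \<in> X
     in \<Oplus>\<^bsub>U\<^esub>p\<in>{p. u p \<noteq> \<zero>\<^bsub>K\<^esub>}. u p \<odot>\<^bsub>U\<^esub> b (fst p) (snd p))"

text \<open>\<open>tensor_map K V W f g\<close> is \<open>f \<otimes> g\<close>, where \<open>V\<close> and \<open>W\<close> are the codomains of \<open>f\<close> and \<open>g\<close>.\<close>

definition tensor_map ::
  "('k, 'm) ring_scheme \<Rightarrow> ('k, 'v, 'n) module_scheme \<Rightarrow> ('k, 'w, 'p) module_scheme
    \<Rightarrow> ('v1 \<Rightarrow> 'v) \<Rightarrow> ('w1 \<Rightarrow> 'w) \<Rightarrow> ('v1 \<times> 'w1 \<Rightarrow> 'k) set \<Rightarrow> ('v \<times> 'w \<Rightarrow> 'k) set"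
  where "tensor_map K V W f g =
    tensor_lift K (tensor K V W) (\<lambda>v w. pure_tensor K V W (f v) (g w))"

text \<open>\<open>tensor_flip K V W\<close> is the map \<open>\<tau>\<close> from \<open>V \<otimes> W\<close> to \<open>W \<otimes> V\<close>.\<close>

definition tensor_flip ::
  "('k, 'm) ring_scheme \<Rightarrow> ('k, 'v, 'n) module_scheme \<Rightarrow> ('k, 'w, 'p) module_scheme
    \<Rightarrow> ('v \<times> 'w \<Rightarrow> 'k) set \<Rightarrow> ('w \<times> 'v \<Rightarrow> 'k) set"
  where "tensor_flip K V W = tensor_lift K (tensor K W V) (\<lambda>v w. pure_tensor K W V w v)"

text \<open>
  The canonical identification of \<open>U \<otimes> (V \<otimes> W)\<close> with \<open>(U \<otimes> V) \<otimes> W\<close>, taking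
  \<open>u \<otimes> (v \<otimes> w)\<close> to \<open>(u \<otimes> v) \<otimes> w\<close>; the coalgebra axioms use it tacitly.
\<close>

definition tensor_assoc ::
  "('k, 'm) ring_scheme \<Rightarrow> ('k, 'u, 'n) module_scheme \<Rightarrow> ('k, 'v, 'p) module_scheme
    \<Rightarrow> ('k, 'w, 'q) module_scheme \<Rightarrow> ('u \<times> ('v \<times> 'w \<Rightarrow> 'k) set \<Rightarrow> 'k) set
    \<Rightarrow> (('u \<times> 'v \<Rightarrow> 'k) set \<times> 'w \<Rightarrow> 'k) set"
  where "tensor_assoc K U V W =
    tensor_lift K (tensor K (tensor K U V) W)
      (\<lambda>u. tensor_lift K (tensor K (tensor K U V) W)
        (\<lambda>v w. pure_tensor K (tensor K U V) W (pure_tensor K U V u v) w))"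


section \<open>The universal property\<close>

text \<open>
  The tensor product is a vector space with a bilinear map \<open>pure_tensor\<close> (\<open>tensor_vectorspace\<close>,
  \<open>pure_bilinear\<close>), and for bilinear \<open>b\<close> the map \<open>tensor_lift K U b\<close> is linear and sends
  \<open>v \<otimes> w\<close> to \<open>b v w\<close> (\<open>tensor_lift_linear\<close>, \<open>tensor_lift_pure\<close>).
\<close>

lemma free_space_simps [simp]:
  "zero (free_space K S) = (\<lambda>s. \<zero>\<^bsub>K\<^esub>)"
  "add (free_space K S) = (\<lambda>u v s. u s \<oplus>\<^bsub>K\<^esub> v s)"
  "smult (free_space K S) = (\<lambda>a u s. a \<otimes>\<^bsub>K\<^esub> u s)"
  by (simp_all add: free_space_def)

lemma free_space_carrier:
  "u \<in> carrier (free_space K S) \<longleftrightarrow> (\<forall>s\<in>S. u s \<in> carrier K) \<and>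
     (\<forall>s. s \<notin> S \<longrightarrow> u s = \<zero>\<^bsub>K\<^esub>) \<and> finite {s. u s \<noteq> \<zero>\<^bsub>K\<^esub>}"
  by (simp add: free_space_def)

context cring begin

lemma free_space_closed: "u \<in> carrier (free_space R S) \<Longrightarrow> u s \<in> carrier R"
  by (cases "s \<in> S") (auto simp: free_space_carrier)

lemma free_space_module: "module R (free_space R S)"
proof (rule module_criteria)
  show "cring R" ..
  show "\<zero>\<^bsub>free_space R S\<^esub> \<in> carrier (free_space R S)" by (simp add: free_space_carrier)
  show "\<forall>v w. v \<in> carrier (free_space R S) \<and> w \<in> carrier (free_space R S) \<longrightarrow>
      v \<oplus>\<^bsub>free_space R S\<^esub> w \<in> carrier (free_space R S)"
  proof (intro allI impI)
    fix v w assume a: "v \<in> carrier (free_space R S) \<and> w \<in> carrier (free_space R S)"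
    have "{s. v s \<oplus> w s \<noteq> \<zero>} \<subseteq> {s. v s \<noteq> \<zero>} \<union> {s. w s \<noteq> \<zero>}"  by auto
    then have "finite {s. v s \<oplus> w s \<noteq> \<zero>}"
      by (rule finite_subset) (use a in \<open>auto simp: free_space_carrier\<close>)
    then show "v \<oplus>\<^bsub>free_space R S\<^esub> w \<in> carrier (free_space R S)"
      using a by (auto simp: free_space_carrier)
  qed
  show "\<forall>v\<in>carrier (free_space R S). \<exists>neg_v\<in>carrier (free_space R S).
       v \<oplus>\<^bsub>free_space R S\<^esub> neg_v = \<zero>\<^bsub>free_space R S\<^esub>"
  proof
    fix v assume a: "v \<in> carrier (free_space R S)"
    have "{s. \<ominus> v s \<noteq> \<zero>} \<subseteq> {s. v s \<noteq> \<zero>}" by auto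
    then have "finite {s. \<ominus> v s \<noteq> \<zero>}"
      by (rule finite_subset) (use a in \<open>auto simp: free_space_carrier\<close>)
    then have "(\<lambda>s. \<ominus> v s) \<in> carrier (free_space R S)"
      using a by (auto simp: free_space_carrier)
    moreover have "v \<oplus>\<^bsub>free_space R S\<^esub> (\<lambda>s. \<ominus> v s) = \<zero>\<^bsub>free_space R S\<^esub>"
      using free_space_closed[OF a] by (auto simp: r_neg)
    ultimately show "\<exists>neg_v\<in>carrier (free_space R S).
       v \<oplus>\<^bsub>free_space R S\<^esub> neg_v = \<zero>\<^bsub>free_space R S\<^esub>" by blast
  qed
  show "\<forall>c v. c \<in> carrier R \<and> v \<in> carrier (free_space R S) \<longrightarrow>
      c \<odot>\<^bsub>free_space R S\<^esub> v \<in> carrier (free_space R S)"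
  proof (intro allI impI)
    fix c v assume a: "c \<in> carrier R \<and> v \<in> carrier (free_space R S)"
    have "{s. c \<otimes> v s \<noteq> \<zero>} \<subseteq> {s. v s \<noteq> \<zero>}" using a by auto
    then have "finite {s. c \<otimes> v s \<noteq> \<zero>}"
      by (rule finite_subset) (use a in \<open>auto simp: free_space_carrier\<close>)
    then show "c \<odot>\<^bsub>free_space R S\<^esub> v \<in> carrier (free_space R S)"
      using a by (auto simp: free_space_carrier)
  qed
qed (auto simp: free_space_closed a_ac l_distr r_distr m_assoc)

lemma free_gen_closed: "s \<in> S \<Longrightarrow> free_gen R s \<in> carrier (free_space R S)"
proof -
  assume "s \<in> S"
  moreover have "{t. free_gen R s t \<noteq> \<zero>} \<subseteq> {s}" by (auto simp: free_gen_def)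
  then have "finite {t. free_gen R s t \<noteq> \<zero>}" by (rule finite_subset) simp
  ultimately show ?thesis by (auto simp: free_space_carrier free_gen_def)
qed

end

context module begin

lemma submodule_abelian_subgroup:
  assumes "LinearCombinations.submodule R N M"
  shows "abelian_subgroup N M"
proof -
  interpret N: LinearCombinations.submodule R N M by fact
  have neg: "\<ominus>\<^bsub>M\<^esub> x \<in> N" if "x \<in> N" for x
    using that N.subset N.smult_closed[of "\<ominus> \<one>" x] smult_minus_1[of x] R.a_inv_closed[OF R.one_closed] by (metis subsetD)
  show ?thesis
  proof (rule abelian_subgroupI3)
    show "additive_subgroup N M"
      by (intro additive_subgroupI M.add.subgroupI)
        (use N.subset N.m_closed neg N.zero_closed in \<open>auto simp del: N.zero_closed\<close>)
  qed (rule M.abelian_group_axioms)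
qed

end

lemma quotient_space_simps [simp]:
  "carrier (quotient_space V N) = a_rcosets\<^bsub>V\<^esub> N"
  "zero (quotient_space V N) = N"
  "add (quotient_space V N) = (\<lambda>X Y. X <+>\<^bsub>V\<^esub> Y)"
  by (simp_all add: quotient_space_def)

context
  fixes R :: "('k, 'm) ring_scheme" and M :: "('k, 'v, 'n) module_scheme" and N
  assumes mM: "module R M" and sN: "LinearCombinations.submodule R N M"
begin

interpretation module R M by (rule mM)
interpretation N: LinearCombinations.submodule R N M by (rule sN)
interpretation A: abelian_subgroup N M by (rule submodule_abelian_subgroup[OF sN])

lemma quotient_eq: 
  assumes "x \<in> carrier M" "y \<in> carrier M"
  shows "N +>\<^bsub>M\<^esub> x = N +>\<^bsub>M\<^esub> y \<longleftrightarrow> x \<ominus>\<^bsub>M\<^esub> y \<in> N"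
  using assms by (metis A.a_rcos_module A.a_rcos_self M.a_repr_independence
      A.a_subgroup a_minus_def)

lemma quotient_add:
  "x \<in> carrier M \<Longrightarrow> y \<in> carrier M \<Longrightarrow>
    (N +>\<^bsub>M\<^esub> x) \<oplus>\<^bsub>quotient_space M N\<^esub> (N +>\<^bsub>M\<^esub> y) = N +>\<^bsub>M\<^esub> (x \<oplus>\<^bsub>M\<^esub> y)"
  by (simp add: A.a_rcos_sum)

lemma quotient_closed: "x \<in> carrier M \<Longrightarrow> N +>\<^bsub>M\<^esub> x \<in> carrier (quotient_space M N)"
  by (simp add: A.a_subset M.a_rcosetsI)

lemma quotient_cases:
  assumes "X \<in> carrier (quotient_space M N)"
  obtains x where "x \<in> carrier M" "X = N +>\<^bsub>M\<^esub> x"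
  using assms by (auto simp: A_RCOSETS_def')

lemma quotient_smult:
  assumes a: "a \<in> carrier R" and x: "x \<in> carrier M"
  shows "a \<odot>\<^bsub>quotient_space M N\<^esub> (N +>\<^bsub>M\<^esub> x) = N +>\<^bsub>M\<^esub> (a \<odot>\<^bsub>M\<^esub> x)"
proof -
  have "N +>\<^bsub>M\<^esub> (a \<odot>\<^bsub>M\<^esub> y) = N +>\<^bsub>M\<^esub> (a \<odot>\<^bsub>M\<^esub> x)" if "y \<in> N +>\<^bsub>M\<^esub> x" for y
  proof -
    have "\<exists>h\<in>N. y = h \<oplus>\<^bsub>M\<^esub> x" using that unfolding a_r_coset_def'[of M] by (simp only: UN_iff singleton_iff)
    then obtain h where h: "h \<in> N" "y = h \<oplus>\<^bsub>M\<^esub> x" by (elim bexE)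
    then have hc: "h \<in> carrier M" using N.subset by auto
    have "a \<odot>\<^bsub>M\<^esub> y = a \<odot>\<^bsub>M\<^esub> h \<oplus>\<^bsub>M\<^esub> a \<odot>\<^bsub>M\<^esub> x" using h hc a x by (simp add: smult_r_distr)
    then have "a \<odot>\<^bsub>M\<^esub> y \<ominus>\<^bsub>M\<^esub> a \<odot>\<^bsub>M\<^esub> x = a \<odot>\<^bsub>M\<^esub> h"
      using hc a x by (simp add: a_minus_def M.a_assoc M.r_neg)
    moreover have "a \<odot>\<^bsub>M\<^esub> h \<in> N" using h a by (intro N.smult_closed)
    moreover have "a \<odot>\<^bsub>M\<^esub> y \<in> carrier M" using h hc a x by auto
    moreover have "a \<odot>\<^bsub>M\<^esub> x \<in> carrier M" using a x by auto
    ultimately show ?thesis using quotient_eq by metis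
  qed
  moreover have "x \<in> N +>\<^bsub>M\<^esub> x" using x by (rule A.a_rcos_self)
  ultimately have "(\<Union>y\<in>N +>\<^bsub>M\<^esub> x. N +>\<^bsub>M\<^esub> (a \<odot>\<^bsub>M\<^esub> y)) = N +>\<^bsub>M\<^esub> (a \<odot>\<^bsub>M\<^esub> x)"
    by blast
  then show ?thesis by (simp only: quotient_space_def module.simps)
qed

lemma quotient_zero: "\<zero>\<^bsub>quotient_space M N\<^esub> = N +>\<^bsub>M\<^esub> \<zero>\<^bsub>M\<^esub>"
  by (simp add: A.a_subset)

lemma quotient_module: "module R (quotient_space M N)"
proof (rule module_criteria)
  show "cring R" ..
  show "\<zero>\<^bsub>quotient_space M N\<^esub> \<in> carrier (quotient_space M N)"
    by (simp add: A.a_subgroup_in_rcosets)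
  show "\<forall>v\<in>carrier (quotient_space M N). \<exists>neg_v\<in>carrier (quotient_space M N).
       v \<oplus>\<^bsub>quotient_space M N\<^esub> neg_v = \<zero>\<^bsub>quotient_space M N\<^esub>"
  proof
    fix v assume "v \<in> carrier (quotient_space M N)"
    then obtain x where x: "x \<in> carrier M" "v = N +>\<^bsub>M\<^esub> x" by (rule quotient_cases)
    have "v \<oplus>\<^bsub>quotient_space M N\<^esub> (N +>\<^bsub>M\<^esub> \<ominus>\<^bsub>M\<^esub> x) = \<zero>\<^bsub>quotient_space M N\<^esub>"
      using x by (simp only: quotient_add quotient_zero M.a_inv_closed M.r_neg)
    then show "\<exists>neg_v\<in>carrier (quotient_space M N).
       v \<oplus>\<^bsub>quotient_space M N\<^esub> neg_v = \<zero>\<^bsub>quotient_space M N\<^esub>"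
      using quotient_closed x by blast
  qed
qed (auto elim!: quotient_cases simp del: quotient_space_simps
   simp: quotient_add quotient_zero quotient_smult M.a_ac smult_l_distr smult_r_distr 
    smult_assoc1 intro!: quotient_closed)

end

definition lin_ext ::
  "('k, 'm) ring_scheme \<Rightarrow> ('k, 'u, 'n) module_scheme \<Rightarrow> ('s \<Rightarrow> 'u) \<Rightarrow> ('s \<Rightarrow> 'k) \<Rightarrow> 'u" where
  "lin_ext K U b u = (\<Oplus>\<^bsub>U\<^esub>p\<in>{p. u p \<noteq> \<zero>\<^bsub>K\<^esub>}. u p \<odot>\<^bsub>U\<^esub> b p)"

context module begin

lemma lin_ext_superset:
  assumes u: "u \<in> carrier (free_space R S)" and b: "b \<in> S \<rightarrow> carrier M"
    and A: "finite A" "{p. u p \<noteq> \<zero>} \<subseteq> A" "A \<subseteq> S"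
  shows "lin_ext R M b u = (\<Oplus>\<^bsub>M\<^esub>p\<in>A. u p \<odot>\<^bsub>M\<^esub> b p)"
  unfolding lin_ext_def
  by (rule M.add.finprod_mono_neutral_cong_left)
    (use assms R.free_space_closed[OF u] in \<open>auto simp: Pi_def subset_iff\<close>)

lemma lin_ext_hom:
  assumes b: "b \<in> S \<rightarrow> carrier M"
  shows "lin_ext R M b \<in> module_hom R (free_space R S) M"
proof -
  interpret F: module R "free_space R S" by (rule free_space_module)
  have sup: "{p. u p \<noteq> \<zero>} \<subseteq> S" "finite {p. u p \<noteq> \<zero>}" if "u \<in> carrier (free_space R S)" for u
    using that by (auto simp: free_space_carrier)
  have cl: "lin_ext R M b u \<in> carrier M" if u: "u \<in> carrier (free_space R S)" for u
    unfolding lin_ext_def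
    by (rule M.finsum_closed) (use sup[OF u] b R.free_space_closed[OF u] in auto)
  have add: "lin_ext R M b (u \<oplus>\<^bsub>free_space R S\<^esub> v) = lin_ext R M b u \<oplus>\<^bsub>M\<^esub> lin_ext R M b v"
    if u: "u \<in> carrier (free_space R S)" and v: "v \<in> carrier (free_space R S)" for u v
  proof -
    let ?A = "{p. u p \<noteq> \<zero>} \<union> {p. v p \<noteq> \<zero>}"
    have A: "finite ?A" "?A \<subseteq> S" using sup[OF u] sup[OF v] by auto
    have bA: "b p \<in> carrier M" if "p \<in> ?A" for p using A that b by auto
    have 1: "lin_ext R M b (u \<oplus>\<^bsub>free_space R S\<^esub> v) = 
        (\<Oplus>\<^bsub>M\<^esub>p\<in>?A. (u \<oplus>\<^bsub>free_space R S\<^esub> v) p \<odot>\<^bsub>M\<^esub> b p)"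
      by (rule lin_ext_superset[OF F.M.a_closed[OF u v] b]) (use A in auto)
    also have "\<dots> = (\<Oplus>\<^bsub>M\<^esub>p\<in>?A. u p \<odot>\<^bsub>M\<^esub> b p \<oplus>\<^bsub>M\<^esub> v p \<odot>\<^bsub>M\<^esub> b p)"
      by (rule M.finsum_cong')
       (use bA R.free_space_closed[OF u] R.free_space_closed[OF v] in \<open>auto simp: smult_l_distr\<close>)
    also have "\<dots> = (\<Oplus>\<^bsub>M\<^esub>p\<in>?A. u p \<odot>\<^bsub>M\<^esub> b p) \<oplus>\<^bsub>M\<^esub> (\<Oplus>\<^bsub>M\<^esub>p\<in>?A. v p \<odot>\<^bsub>M\<^esub> b p)"
      by (rule M.finsum_addf)
       (use bA R.free_space_closed[OF u] R.free_space_closed[OF v] in auto)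
    also have "(\<Oplus>\<^bsub>M\<^esub>p\<in>?A. u p \<odot>\<^bsub>M\<^esub> b p) = lin_ext R M b u"
      by (rule lin_ext_superset[OF u b, symmetric]) (use A in auto)
    also have "(\<Oplus>\<^bsub>M\<^esub>p\<in>?A. v p \<odot>\<^bsub>M\<^esub> b p) = lin_ext R M b v"
      by (rule lin_ext_superset[OF v b, symmetric]) (use A in auto)
    finally show ?thesis .
  qed
  have sm: "lin_ext R M b (a \<odot>\<^bsub>free_space R S\<^esub> u) = a \<odot>\<^bsub>M\<^esub> lin_ext R M b u"
    if a: "a \<in> carrier R" and u: "u \<in> carrier (free_space R S)" for a u
  proof -
    let ?A = "{p. u p \<noteq> \<zero>}"
    have bA: "b p \<in> carrier M" if "p \<in> ?A" for p using sup[OF u] that b by auto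
    have "lin_ext R M b (a \<odot>\<^bsub>free_space R S\<^esub> u) = 
        (\<Oplus>\<^bsub>M\<^esub>p\<in>?A. (a \<odot>\<^bsub>free_space R S\<^esub> u) p \<odot>\<^bsub>M\<^esub> b p)"
      by (rule lin_ext_superset[OF F.smult_closed[OF a u] b]) (use sup[OF u] a in auto)
    also have "\<dots> = (\<Oplus>\<^bsub>M\<^esub>p\<in>?A. a \<odot>\<^bsub>M\<^esub> (u p \<odot>\<^bsub>M\<^esub> b p))"
      by (rule M.finsum_cong')
       (use bA R.free_space_closed[OF u] a in \<open>auto simp: smult_assoc1\<close>)
    also have "\<dots> = a \<odot>\<^bsub>M\<^esub> lin_ext R M b u"
      unfolding lin_ext_def
      by (rule finsum_smult_ldistr[symmetric])
        (use bA sup[OF u] R.free_space_closed[OF u] a in auto)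
    finally show ?thesis .
  qed
  show ?thesis unfolding module_hom_def using cl add sm by auto
qed

lemma lin_ext_gen:
  assumes b: "b \<in> S \<rightarrow> carrier M" and s: "s \<in> S"
  shows "lin_ext R M b (free_gen R s) = b s"
proof -
  have "lin_ext R M b (free_gen R s) = (\<Oplus>\<^bsub>M\<^esub>p\<in>{s}. free_gen R s p \<odot>\<^bsub>M\<^esub> b p)"
    by (rule lin_ext_superset[OF R.free_gen_closed[OF s] b]) (use s in \<open>auto simp: free_gen_def\<close>)
  also have "\<dots> = b s"
    using funcset_mem[OF b s] by (subst M.finsum_insert) (auto simp: free_gen_def)
  finally show ?thesis .
qed

end

locale tensor_spaces = V: vectorspace K V + W: vectorspace K W
  for K :: "('k, 'm) ring_scheme" and V :: "('k, 'v, 'n) module_scheme"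
    and W :: "('k, 'w, 'p) module_scheme"
begin

abbreviation "FS \<equiv> free_space K (carrier V \<times> carrier W)"

sublocale F: module K FS by (rule V.free_space_module)

lemma gen_closed: "v \<in> carrier V \<Longrightarrow> w \<in> carrier W \<Longrightarrow> free_gen K (v, w) \<in> carrier FS"
  by (rule V.free_gen_closed) auto

lemma relations_closed: "tensor_relations K V W \<subseteq> carrier FS"
  unfolding tensor_relations_def Let_def
  by (auto simp del: free_space_simps intro!: F.M.minus_closed F.M.a_closed F.smult_closed gen_closed)

lemma null_submodule: "LinearCombinations.submodule K (tensor_null K V W) FS"
  unfolding tensor_null_def by (rule F.span_is_submodule[OF relations_closed])

sublocale A: abelian_subgroup "tensor_null K V W" FS
  by (rule F.submodule_abelian_subgroup[OF null_submodule])

lemma tensor_vectorspace: "vectorspace K (tensor K V W)"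
  unfolding vectorspace_def tensor_def
  using quotient_module[OF F.module_axioms null_submodule] V.field_axioms by blast

lemma pure_closed: "v \<in> carrier V \<Longrightarrow> w \<in> carrier W \<Longrightarrow> pure_tensor K V W v w \<in> carrier (tensor K V W)"
  unfolding tensor_def pure_tensor_def
  by (rule quotient_closed[OF F.module_axioms null_submodule gen_closed])

lemma pure_bilinear:
  "\<lbrakk>v \<in> carrier V; v' \<in> carrier V; w \<in> carrier W\<rbrakk> \<Longrightarrow>
     pure_tensor K V W (v \<oplus>\<^bsub>V\<^esub> v') w = 
     pure_tensor K V W v w \<oplus>\<^bsub>tensor K V W\<^esub> pure_tensor K V W v' w"
  "\<lbrakk>v \<in> carrier V; w \<in> carrier W; w' \<in> carrier W\<rbrakk> \<Longrightarrow>
     pure_tensor K V W v (w \<oplus>\<^bsub>W\<^esub> w') = 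
     pure_tensor K V W v w \<oplus>\<^bsub>tensor K V W\<^esub> pure_tensor K V W v w'"
  "\<lbrakk>a \<in> carrier K; v \<in> carrier V; w \<in> carrier W\<rbrakk> \<Longrightarrow>
     pure_tensor K V W (a \<odot>\<^bsub>V\<^esub> v) w = a \<odot>\<^bsub>tensor K V W\<^esub> pure_tensor K V W v w"
  "\<lbrakk>a \<in> carrier K; v \<in> carrier V; w \<in> carrier W\<rbrakk> \<Longrightarrow>
     pure_tensor K V W v (a \<odot>\<^bsub>W\<^esub> w) = a \<odot>\<^bsub>tensor K V W\<^esub> pure_tensor K V W v w"
proof -
  note q = quotient_eq[OF F.module_axioms null_submodule]
    quotient_add[OF F.module_axioms null_submodule]
    quotient_smult[OF F.module_axioms null_submodule]
  have r: "x \<in> tensor_relations K V W \<Longrightarrow> x \<in> tensor_null K V W" for x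
    unfolding tensor_null_def using F.in_own_span[OF relations_closed] by blast
  show "\<lbrakk>v \<in> carrier V; v' \<in> carrier V; w \<in> carrier W\<rbrakk> \<Longrightarrow>
     pure_tensor K V W (v \<oplus>\<^bsub>V\<^esub> v') w = 
     pure_tensor K V W v w \<oplus>\<^bsub>tensor K V W\<^esub> pure_tensor K V W v' w"
    unfolding pure_tensor_def tensor_def
    apply (simp only: q gen_closed)
    apply (subst q)
    apply (simp_all only: gen_closed F.M.a_closed V.M.a_closed V.smult_closed)
    apply (rule r) unfolding tensor_relations_def Let_def by blast
  show "\<lbrakk>v \<in> carrier V; w \<in> carrier W; w' \<in> carrier W\<rbrakk> \<Longrightarrow>
     pure_tensor K V W v (w \<oplus>\<^bsub>W\<^esub> w') = 
     pure_tensor K V W v w \<oplus>\<^bsub>tensor K V W\<^esub> pure_tensor K V W v w'"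
    unfolding pure_tensor_def tensor_def
    apply (simp only: q gen_closed)
    apply (subst q)
    apply (simp_all only: gen_closed F.M.a_closed W.M.a_closed V.smult_closed)
    apply (rule r) unfolding tensor_relations_def Let_def by blast
  show "\<lbrakk>a \<in> carrier K; v \<in> carrier V; w \<in> carrier W\<rbrakk> \<Longrightarrow>
     pure_tensor K V W (a \<odot>\<^bsub>V\<^esub> v) w = a \<odot>\<^bsub>tensor K V W\<^esub> pure_tensor K V W v w"
    unfolding pure_tensor_def tensor_def
    apply (simp only: q gen_closed)
    apply (subst q)
    apply (simp_all only: gen_closed F.M.a_closed V.M.a_closed V.smult_closed F.smult_closed)
    apply (rule r) unfolding tensor_relations_def Let_def by blast
  show "\<lbrakk>a \<in> carrier K; v \<in> carrier V; w \<in> carrier W\<rbrakk> \<Longrightarrow>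
     pure_tensor K V W v (a \<odot>\<^bsub>W\<^esub> w) = a \<odot>\<^bsub>tensor K V W\<^esub> pure_tensor K V W v w"
    unfolding pure_tensor_def tensor_def
    apply (simp only: q gen_closed)
    apply (subst q)
    apply (simp_all only: gen_closed F.M.a_closed V.M.a_closed W.smult_closed F.smult_closed)
    apply (rule r) unfolding tensor_relations_def Let_def by blast
qed

context
  fixes U :: "('k, 'u, 'q) module_scheme" and b
  assumes U: "vectorspace K U"
    and b_closed: "\<And>v w. v \<in> carrier V \<Longrightarrow> w \<in> carrier W \<Longrightarrow> b v w \<in> carrier U"
    and b_add1: "\<And>v v' w. v \<in> carrier V \<Longrightarrow> v' \<in> carrier V \<Longrightarrow> w \<in> carrier W \<Longrightarrow>
      b (v \<oplus>\<^bsub>V\<^esub> v') w = b v w \<oplus>\<^bsub>U\<^esub> b v' w"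
    and b_add2: "\<And>v w w'. v \<in> carrier V \<Longrightarrow> w \<in> carrier W \<Longrightarrow> w' \<in> carrier W \<Longrightarrow>
      b v (w \<oplus>\<^bsub>W\<^esub> w') = b v w \<oplus>\<^bsub>U\<^esub> b v w'"
    and b_smult1: "\<And>a v w. a \<in> carrier K \<Longrightarrow> v \<in> carrier V \<Longrightarrow> w \<in> carrier W \<Longrightarrow>
      b (a \<odot>\<^bsub>V\<^esub> v) w = a \<odot>\<^bsub>U\<^esub> b v w"
    and b_smult2: "\<And>a v w. a \<in> carrier K \<Longrightarrow> v \<in> carrier V \<Longrightarrow> w \<in> carrier W \<Longrightarrow>
      b v (a \<odot>\<^bsub>W\<^esub> w) = a \<odot>\<^bsub>U\<^esub> b v w"
begin

interpretation U: vectorspace K U by (rule U)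

abbreviation "LE \<equiv> lin_ext K U (\<lambda>p. b (fst p) (snd p))"

lemma b_Pi: "(\<lambda>p. b (fst p) (snd p)) \<in> carrier V \<times> carrier W \<rightarrow> carrier U"
  using b_closed by auto

interpretation L: mod_hom K FS U LE
  by unfold_locales (rule U.lin_ext_hom[OF b_Pi])

lemma LE_gen: "v \<in> carrier V \<Longrightarrow> w \<in> carrier W \<Longrightarrow> LE (free_gen K (v, w)) = b v w"
  by (subst U.lin_ext_gen[OF b_Pi]) auto

lemma LE_null: "x \<in> tensor_null K V W \<Longrightarrow> LE x = \<zero>\<^bsub>U\<^esub>"
proof -
  have "tensor_relations K V W \<subseteq> L.ker"
    unfolding tensor_relations_def Let_def L.ker_def
    by (auto simp del: free_space_simps simp: gen_closed LE_gen b_add1 b_add2 b_smult1 b_smult2 b_closed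
      intro!: F.M.minus_closed F.M.a_closed F.smult_closed gen_closed)
  then have "tensor_null K V W \<subseteq> L.ker"
    unfolding tensor_null_def by (rule F.span_is_subset[OF _ L.ker_is_submodule])
  then show "x \<in> tensor_null K V W \<Longrightarrow> LE x = \<zero>\<^bsub>U\<^esub>" by (auto simp: L.ker_def)
qed

lemma tensor_lift_coset:
  assumes u: "u \<in> carrier FS"
  shows "tensor_lift K U b (tensor_null K V W +>\<^bsub>FS\<^esub> u) = LE u"
proof -
  let ?X = "tensor_null K V W +>\<^bsub>FS\<^esub> u"
  have "(SOME u. u \<in> ?X) \<in> ?X" by (rule someI[of _ u]) (rule A.a_rcos_self[OF u])
  then obtain h where h: "h \<in> tensor_null K V W" "(SOME u. u \<in> ?X) = h \<oplus>\<^bsub>FS\<^esub> u"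
    unfolding a_r_coset_def'[of FS] by blast
  then have "h \<in> carrier FS" using A.a_subset by blast
  have "tensor_lift K U b ?X = LE (SOME u. u \<in> ?X)"
    unfolding tensor_lift_def Let_def lin_ext_def ..
  also have "\<dots> = LE h \<oplus>\<^bsub>U\<^esub> LE u" unfolding h(2) by (rule L.f_add) fact+
  finally show ?thesis using LE_null[OF h(1)] L.f_im[OF u] by simp
qed

lemma tensor_lift_pure: "v \<in> carrier V \<Longrightarrow> w \<in> carrier W \<Longrightarrow>
  tensor_lift K U b (pure_tensor K V W v w) = b v w"
  unfolding pure_tensor_def by (simp only: tensor_lift_coset gen_closed LE_gen)

lemma tensor_lift_linear: "linear_map K (tensor K V W) U (tensor_lift K U b)"
proof -
  interpret T: vectorspace K "tensor K V W" by (rule tensor_vectorspace)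
  note q = quotient_add[OF F.module_axioms null_submodule]
    quotient_smult[OF F.module_axioms null_submodule]
  let ?q = "\<lambda>x. tensor_null K V W +>\<^bsub>FS\<^esub> x"
  have cases: "\<exists>x\<in>carrier FS. X = ?q x" if "X \<in> carrier (tensor K V W)" for X
    using that unfolding tensor_def quotient_space_simps A_RCOSETS_def'[of FS] by blast
  have 1: "tensor_lift K U b (?q x) \<in> carrier U" if "x \<in> carrier FS" for x
    unfolding tensor_lift_coset[OF that] by (rule L.f_im[OF that])
  have 2: "tensor_lift K U b (?q x \<oplus>\<^bsub>tensor K V W\<^esub> ?q y) =
      tensor_lift K U b (?q x) \<oplus>\<^bsub>U\<^esub> tensor_lift K U b (?q y)"
    if x: "x \<in> carrier FS" and y: "y \<in> carrier FS" for x y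
    unfolding tensor_def q(1)[OF x y] tensor_lift_coset[OF x] tensor_lift_coset[OF y]
      tensor_lift_coset[OF F.M.a_closed[OF x y]] by (rule L.f_add[OF x y])
  have 3: "tensor_lift K U b (a \<odot>\<^bsub>tensor K V W\<^esub> ?q x) = a \<odot>\<^bsub>U\<^esub> tensor_lift K U b (?q x)"
    if a: "a \<in> carrier K" and x: "x \<in> carrier FS" for a x
    unfolding tensor_def q(2)[OF a x] tensor_lift_coset[OF x]
      tensor_lift_coset[OF F.smult_closed[OF a x]] by (rule L.f_smult[OF a x])
  have "tensor_lift K U b \<in> module_hom K (tensor K V W) U"
    unfolding module_hom_def
  proof (intro CollectI conjI allI impI funcsetI)
    fix X assume X: "X \<in> carrier (tensor K V W)"
    show "tensor_lift K U b X \<in> carrier U" using cases[OF X] 1 by blast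
  next
    fix X Y assume XY: "X \<in> carrier (tensor K V W) \<and> Y \<in> carrier (tensor K V W)"
    show "tensor_lift K U b (X \<oplus>\<^bsub>tensor K V W\<^esub> Y) = tensor_lift K U b X \<oplus>\<^bsub>U\<^esub> tensor_lift K U b Y"
      using cases[OF conjunct1[OF XY]] cases[OF conjunct2[OF XY]] 2 by blast
  next
    fix a X assume aX: "a \<in> carrier K \<and> X \<in> carrier (tensor K V W)"
    show "tensor_lift K U b (a \<odot>\<^bsub>tensor K V W\<^esub> X) = a \<odot>\<^bsub>U\<^esub> tensor_lift K U b X"
      using cases[OF conjunct2[OF aX]] 3 aX by blast
  qed
  then show ?thesis
   by (intro linear_map.intro mod_hom.intro mod_hom_axioms.intro T.vectorspace_axioms U T.module_axioms U.module_axioms)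
qed

end
end


section \<open>Hom-coalgebras\<close>

definition char_zero :: "('k, 'm) ring_scheme \<Rightarrow> bool"
  where "char_zero K \<longleftrightarrow> (\<forall>n::nat. n > 0 \<longrightarrow> [n] \<cdot>\<^bsub>K\<^esub> \<one>\<^bsub>K\<^esub> \<noteq> \<zero>\<^bsub>K\<^esub>)"

locale hom_coalgebra_data = vectorspace K C
  for K :: "('k, 'm) ring_scheme" and C :: "('k, 'c, 'n) module_scheme" +
  fixes \<Delta> :: "'c \<Rightarrow> ('c \<times> 'c \<Rightarrow> 'k) set" and \<alpha> :: "'c \<Rightarrow> 'c"
  assumes comult_linear: "linear_map K C (tensor K C C) \<Delta>"
    and twist_linear: "linear_map K C C \<alpha>"
begin

text \<open>Both three-fold comultiplications take values in \<open>(C \<otimes> C) \<otimes> C\<close>.\<close>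

definition comult_left :: "'c \<Rightarrow> (('c \<times> 'c \<Rightarrow> 'k) set \<times> 'c \<Rightarrow> 'k) set"
  where "comult_left c = tensor_map K (tensor K C C) C \<Delta> \<alpha> (\<Delta> c)"

definition comult_right :: "'c \<Rightarrow> (('c \<times> 'c \<Rightarrow> 'k) set \<times> 'c \<Rightarrow> 'k) set"
  where "comult_right c = tensor_assoc K C C C (tensor_map K C (tensor K C C) \<alpha> \<Delta> (\<Delta> c))"

definition coassociator :: "'c \<Rightarrow> (('c \<times> 'c \<Rightarrow> 'k) set \<times> 'c \<Rightarrow> 'k) set"
  where "coassociator c = comult_left c \<ominus>\<^bsub>tensor K (tensor K C C) C\<^esub> comult_right c"

end

locale hom_coassociative_coalgebra = hom_coalgebra_data +
  assumes hom_coassociative: "c \<in> carrier C \<Longrightarrow> comult_right c = comult_left c"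

locale hom_coassociative_rota_baxter_coalgebra = hom_coassociative_coalgebra K C \<Delta> \<alpha>
  for K :: "('k, 'm) ring_scheme" and C :: "('k, 'c, 'n) module_scheme" and \<Delta> \<alpha> +
  fixes R :: "'c \<Rightarrow> 'c" and weight :: 'k
  assumes weight_closed: "weight \<in> carrier K"
    and rota_baxter_linear: "linear_map K C C R"
    and rota_baxter_twist: "c \<in> carrier C \<Longrightarrow> R (\<alpha> c) = \<alpha> (R c)"
    and rota_baxter: "c \<in> carrier C \<Longrightarrow>
      tensor_map K C C R R (\<Delta> c) =
        tensor_map K C C R id (\<Delta> (R c)) \<oplus>\<^bsub>tensor K C C\<^esub>
        tensor_map K C C id R (\<Delta> (R c)) \<oplus>\<^bsub>tensor K C C\<^esub>
        weight \<odot>\<^bsub>tensor K C C\<^esub> \<Delta> (R c)"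

locale hom_preLie_coalgebra = hom_coalgebra_data +
  assumes hom_preLie: "c \<in> carrier C \<Longrightarrow>
    coassociator c = tensor_map K (tensor K C C) C (tensor_flip K C C) id (coassociator c)"

text \<open>\<open>(R \<otimes> I) \<circ> \<Delta> - \<tau> \<circ> (I \<otimes> R) \<circ> \<Delta> - \<Delta>\<close>\<close>

definition rota_baxter_comult ::
  "('k, 'm) ring_scheme \<Rightarrow> ('k, 'c, 'n) module_scheme \<Rightarrow> ('c \<Rightarrow> ('c \<times> 'c \<Rightarrow> 'k) set)
    \<Rightarrow> ('c \<Rightarrow> 'c) \<Rightarrow> 'c \<Rightarrow> ('c \<times> 'c \<Rightarrow> 'k) set"
  where "rota_baxter_comult K C \<Delta> R c =
    tensor_map K C C R id (\<Delta> c) \<ominus>\<^bsub>tensor K C C\<^esub>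
    tensor_flip K C C (tensor_map K C C id R (\<Delta> c)) \<ominus>\<^bsub>tensor K C C\<^esub> \<Delta> c"

end

theory Submission
  imports Defs
begin

text \<open>
  Dually, let \<open>R x R y = R {x, y}\<close> with \<open>{x, y} = R x y + x R y - x y\<close>. The product
  \<open>x * y = R x y - y R x - x y\<close> satisfies \<open>x * y - y * x = {x, y} - {y, x}\<close>, so in its
  antisymmetrized associator \<open>R (x * y - y * x)\<close> becomes \<open>R x R y - R y R x\<close>. What remains are
  products of \<open>x\<close>, \<open>y\<close>, \<open>z\<close> in some order with \<open>R\<close> applied to some factors, and they cancel. For the
  coalgebra, both antisymmetrized threefold comultiplications of the new coproduct are images of
  the single element \<open>(\<Delta> \<otimes> \<alpha>) \<Delta> c = (\<alpha> \<otimes> \<Delta>) \<Delta> c\<close> under linear endomorphisms of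
  \<open>C \<otimes> C \<otimes> C\<close>, which are compared on pure tensors.
\<close>

section \<open>Linear maps\<close>

lemma (in abelian_group) diff_eq_zero_iff:
  assumes "x \<in> carrier G" "y \<in> carrier G"
  shows "x \<ominus> y = \<zero> \<longleftrightarrow> x = y"
  using assms by (metis a_minus_def add.inv_closed minus_equality minus_minus r_neg)

lemma linear_mapI:
  assumes "vectorspace K V" "vectorspace K W"
    and "\<And>x. x \<in> carrier V \<Longrightarrow> f x \<in> carrier W"
    and "\<And>x y. x \<in> carrier V \<Longrightarrow> y \<in> carrier V \<Longrightarrow> f (x \<oplus>\<^bsub>V\<^esub> y) = f x \<oplus>\<^bsub>W\<^esub> f y"
    and "\<And>a x. a \<in> carrier K \<Longrightarrow> x \<in> carrier V \<Longrightarrow> f (a \<odot>\<^bsub>V\<^esub> x) = a \<odot>\<^bsub>W\<^esub> f x"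
  shows "linear_map K V W f"
proof -
  interpret V: vectorspace K V by fact
  interpret W: vectorspace K W by fact
  show ?thesis
    by unfold_locales (use assms in \<open>auto simp: module_hom_def\<close>)
qed

lemma linear_map_vectorspaces:
  assumes "linear_map K V W f"
  shows "vectorspace K V" "vectorspace K W"
  using assms by (auto simp: linear_map_def)

lemma (in vectorspace) linear_map_id: "linear_map K V V (\<lambda>x. x)"
  by (rule linear_mapI) (auto intro: vectorspace_axioms)

lemma linear_map_comp:
  assumes "linear_map K V W f" "linear_map K W U g"
  shows "linear_map K V U (\<lambda>x. g (f x))"
proof -
  interpret f: linear_map K V W f by fact
  interpret g: linear_map K W U g by fact
  show ?thesis
    by (intro linear_mapI f.V.vectorspace_axioms g.W.vectorspace_axioms) auto
qed

lemma linear_map_add: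
  assumes "linear_map K V W f" "linear_map K V W g"
  shows "linear_map K V W (\<lambda>x. f x \<oplus>\<^bsub>W\<^esub> g x)"
proof -
  interpret V: vectorspace K V by (rule linear_map_vectorspaces(1)[OF assms(1)])
  interpret W: vectorspace K W by (rule linear_map_vectorspaces(2)[OF assms(1)])
  interpret f: linear_map K V W f by fact
  interpret g: linear_map K V W g by fact
  show ?thesis
    by (intro linear_mapI V.vectorspace_axioms W.vectorspace_axioms)
      (auto simp: W.M.a_ac W.smult_r_distr)
qed

lemma linear_map_diff:
  assumes "linear_map K V W f" "linear_map K V W g"
  shows "linear_map K V W (\<lambda>x. f x \<ominus>\<^bsub>W\<^esub> g x)"
proof -
  interpret V: vectorspace K V by (rule linear_map_vectorspaces(1)[OF assms(1)])
  interpret W: vectorspace K W by (rule linear_map_vectorspaces(2)[OF assms(1)])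
  interpret f: linear_map K V W f by fact
  interpret g: linear_map K V W g by fact
  show ?thesis
    by (intro linear_mapI V.vectorspace_axioms W.vectorspace_axioms)
      (auto simp: a_minus_def W.M.a_ac W.M.minus_add W.smult_r_distr W.smult_r_minus)
qed

lemma (in vectorspace) linear_map_smult:
  "a \<in> carrier K \<Longrightarrow> linear_map K V V (\<lambda>x. a \<odot>\<^bsub>V\<^esub> x)"
  by (rule linear_mapI)
    (auto simp: smult_r_distr m_comm vectorspace_axioms simp flip: smult_assoc1)

section \<open>Uniqueness of linear maps given on generators\<close>

context module begin

text \<open>Induction on the support of \<open>u\<close>: the maps agree on the generator that is
  split off and, by the induction hypothesis, on the remainder.\<close>

lemma free_space_hom_eq:
  assumes h: "h \<in> module_hom R (free_space R S) M" and k: "k \<in> module_hom R (free_space R S) M"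
    and gen: "\<And>s. s \<in> S \<Longrightarrow> h (free_gen R s) = k (free_gen R s)"
    and u: "u \<in> carrier (free_space R S)"
  shows "h u = k u"
proof -
  let ?F = "free_space R S"
  interpret F: module R ?F by (rule free_space_module)
  interpret h: mod_hom R ?F M h by unfold_locales (rule h)
  interpret k: mod_hom R ?F M k by unfold_locales (rule k)
  have "finite {s. u s \<noteq> \<zero>}" using u by (simp add: free_space_carrier)
  then show ?thesis using u
  proof (induction "{s. u s \<noteq> \<zero>}" arbitrary: u rule: finite_induct)
    case empty
    then have "u = \<zero>\<^bsub>?F\<^esub>" by auto
    then show ?case by (metis h.f0_is_0 k.f0_is_0)
  next
    case (insert s A)
    \<comment> \<open>Deleting \<open>s\<close> leaves the support \<open>A\<close>, to which the
      induction hypothesis applies; \<open>dec\<close> restores the deleted term.\<close>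
    let ?v = "u(s := \<zero>)"
    have A: "A = {t. ?v t \<noteq> \<zero>}" using insert.hyps by auto
    have s: "s \<in> S" using insert.hyps insert.prems by (auto simp: free_space_carrier)
    have us: "u s \<in> carrier R" by (rule R.free_space_closed[OF insert.prems])
    have "finite {t. ?v t \<noteq> \<zero>}" using insert.hyps(1) by (simp only: A[symmetric])
    then have v: "?v \<in> carrier ?F"
      using insert.prems unfolding free_space_carrier by simp
    note g = R.free_gen_closed[OF s]
    have ut: "u t \<in> carrier R" for t by (rule R.free_space_closed[OF insert.prems])
    have dec: "u = ?v \<oplus>\<^bsub>?F\<^esub> u s \<odot>\<^bsub>?F\<^esub> free_gen R s"
      using ut by (auto simp: free_gen_def)
    note c = F.smult_closed[OF us g]
    have "h u = h ?v \<oplus>\<^bsub>M\<^esub> u s \<odot>\<^bsub>M\<^esub> h (free_gen R s)"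
      by (subst dec) (simp only: h.f_add[OF v c] h.f_smult[OF us g])
    also have "\<dots> = k ?v \<oplus>\<^bsub>M\<^esub> u s \<odot>\<^bsub>M\<^esub> k (free_gen R s)"
      using insert.hyps(3)[OF A v] gen[OF s] by simp
    also have "\<dots> = k u"
      by (subst (3) dec) (simp only: k.f_add[OF v c] k.f_smult[OF us g])
    finally show ?case .
  qed
qed

end

context tensor_spaces begin

text \<open>Composing with the projection from the free space reduces the claim to generators, whose
  cosets are the pure tensors. The operator identities below are checked on pure tensors by means of
  it.\<close>

lemma tensor_linear_map_eq:
  assumes f: "linear_map K (tensor K V W) U f" and g: "linear_map K (tensor K V W) U g"
    and pure: "\<And>v w. v \<in> carrier V \<Longrightarrow> w \<in> carrier W \<Longrightarrow>
      f (pure_tensor K V W v w) = g (pure_tensor K V W v w)"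
    and t: "t \<in> carrier (tensor K V W)"
  shows "f t = g t"
proof -
  interpret U: vectorspace K U by (rule linear_map_vectorspaces(2)[OF f])
  let ?q = "\<lambda>u. tensor_null K V W +>\<^bsub>FS\<^esub> u"
  note qc = quotient_closed[OF F.module_axioms null_submodule, folded tensor_def]
  note qa = quotient_add[OF F.module_axioms null_submodule, folded tensor_def]
  note qs = quotient_smult[OF F.module_axioms null_submodule, folded tensor_def]
  have hom: "(\<lambda>u. h (?q u)) \<in> module_hom K FS U" if "linear_map K (tensor K V W) U h" for h
  proof -
    interpret h: linear_map K "tensor K V W" U h by fact
    show ?thesis unfolding module_hom_def
    proof (intro CollectI conjI allI impI funcsetI)
      fix x assume "x \<in> carrier FS"
      then show "h (?q x) \<in> carrier U" by (intro h.f_im qc)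
    next
      fix x y assume a: "x \<in> carrier FS \<and> y \<in> carrier FS"
      then show "h (?q (x \<oplus>\<^bsub>FS\<^esub> y)) = h (?q x) \<oplus>\<^bsub>U\<^esub> h (?q y)"
        by (metis qa qc h.f_add)
    next
      fix a x assume a: "a \<in> carrier K \<and> x \<in> carrier FS"
      then show "h (?q (a \<odot>\<^bsub>FS\<^esub> x)) = a \<odot>\<^bsub>U\<^esub> h (?q x)"
        by (metis qs qc h.f_smult)
    qed
  qed
  obtain u where u: "u \<in> carrier FS" "t = ?q u"
    using t quotient_cases[OF F.module_axioms null_submodule] unfolding tensor_def by metis
  have "f (?q u) = g (?q u)"
    by (rule U.free_space_hom_eq[OF hom[OF f] hom[OF g] _ u(1)])
      (use pure in \<open>auto simp: pure_tensor_def\<close>)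
  then show ?thesis using u by simp
qed

end

section \<open>Maps between tensor products\<close>

lemma tensor_map_linear_pure:
  assumes f: "linear_map K V V' f" and g: "linear_map K W W' g"
  shows tensor_map_linear: "linear_map K (tensor K V W) (tensor K V' W') (tensor_map K V' W' f g)"
    and tensor_map_pure: "\<lbrakk>v \<in> carrier V; w \<in> carrier W\<rbrakk> \<Longrightarrow>
      tensor_map K V' W' f g (pure_tensor K V W v w) = pure_tensor K V' W' (f v) (g w)"
proof -
  interpret f: linear_map K V V' f by fact
  interpret g: linear_map K W W' g by fact
  interpret VW: tensor_spaces K V W
    by (intro tensor_spaces.intro linear_map_vectorspaces[OF f] linear_map_vectorspaces[OF g])
  interpret VW': tensor_spaces K V' W'
    by (intro tensor_spaces.intro linear_map_vectorspaces[OF f] linear_map_vectorspaces[OF g])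
  show "linear_map K (tensor K V W) (tensor K V' W') (tensor_map K V' W' f g)"
    unfolding tensor_map_def
    by (rule VW.tensor_lift_linear)
      (simp_all add: VW'.tensor_vectorspace VW'.pure_closed VW'.pure_bilinear)
  show "tensor_map K V' W' f g (pure_tensor K V W v w) = pure_tensor K V' W' (f v) (g w)"
    if "v \<in> carrier V" "w \<in> carrier W"
    unfolding tensor_map_def
    by (rule VW.tensor_lift_pure)
      (simp_all add: VW'.tensor_vectorspace VW'.pure_closed VW'.pure_bilinear that)
qed

lemma tensor_flip_linear_pure:
  assumes V: "vectorspace K V" and W: "vectorspace K W"
  shows tensor_flip_linear: "linear_map K (tensor K V W) (tensor K W V) (tensor_flip K V W)"
    and tensor_flip_pure: "\<lbrakk>v \<in> carrier V; w \<in> carrier W\<rbrakk> \<Longrightarrow>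
      tensor_flip K V W (pure_tensor K V W v w) = pure_tensor K W V w v"
proof -
  interpret VW: tensor_spaces K V W by (intro tensor_spaces.intro V W)
  interpret WV: tensor_spaces K W V by (intro tensor_spaces.intro V W)
  show "linear_map K (tensor K V W) (tensor K W V) (tensor_flip K V W)"
    unfolding tensor_flip_def
    by (rule VW.tensor_lift_linear)
      (simp_all add: WV.tensor_vectorspace WV.pure_closed WV.pure_bilinear)
  show "tensor_flip K V W (pure_tensor K V W v w) = pure_tensor K W V w v"
    if "v \<in> carrier V" "w \<in> carrier W"
    unfolding tensor_flip_def
    by (rule VW.tensor_lift_pure)
      (simp_all add: WV.tensor_vectorspace WV.pure_closed WV.pure_bilinear that)
qed

lemma tensor_assoc_linear_pure:
  assumes U: "vectorspace K U" and V: "vectorspace K V" and W: "vectorspace K W"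
  shows tensor_assoc_linear: "linear_map K (tensor K U (tensor K V W)) (tensor K (tensor K U V) W)
      (tensor_assoc K U V W)"
    and tensor_assoc_pure: "\<lbrakk>u \<in> carrier U; v \<in> carrier V; w \<in> carrier W\<rbrakk> \<Longrightarrow>
      tensor_assoc K U V W (pure_tensor K U (tensor K V W) u (pure_tensor K V W v w)) =
      pure_tensor K (tensor K U V) W (pure_tensor K U V u v) w"
proof -
  interpret UV: tensor_spaces K U V by (intro tensor_spaces.intro U V)
  interpret VW: tensor_spaces K V W by (intro tensor_spaces.intro V W)
  interpret U_VW: tensor_spaces K U "tensor K V W"
    by (intro tensor_spaces.intro U VW.tensor_vectorspace)
  interpret UV_W: tensor_spaces K "tensor K U V" W
    by (intro tensor_spaces.intro W UV.tensor_vectorspace)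
  let ?T = "tensor K (tensor K U V) W"
  interpret T: vectorspace K ?T by (rule UV_W.tensor_vectorspace)
  let ?b = "\<lambda>u v w. pure_tensor K (tensor K U V) W (pure_tensor K U V u v) w"
  let ?l = "\<lambda>u. tensor_lift K ?T (?b u)"
  note b = UV_W.tensor_vectorspace UV_W.pure_closed UV.pure_closed UV.pure_bilinear
    UV_W.pure_bilinear
  have lin: "linear_map K (tensor K V W) ?T (?l u)" if "u \<in> carrier U" for u
    by (rule VW.tensor_lift_linear) (simp_all add: b that)
  have pure: "?l u (pure_tensor K V W v w) = ?b u v w"
    if "u \<in> carrier U" "v \<in> carrier V" "w \<in> carrier W" for u v w
    by (rule VW.tensor_lift_pure) (simp_all add: b that)
  have closed: "?l u t \<in> carrier ?T" if "u \<in> carrier U" "t \<in> carrier (tensor K V W)" for u t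
  proof -
    interpret linear_map K "tensor K V W" ?T "?l u" by (rule lin) fact
    show ?thesis using that(2) by simp
  qed
  \<comment> \<open>An arbitrary \<open>t\<close> need not be pure, so linearity in \<open>u\<close>
    comes from uniqueness: both sides are linear in \<open>t\<close> and agree on pure
    tensors.\<close>
  have add: "?l (u \<oplus>\<^bsub>U\<^esub> u') t = ?l u t \<oplus>\<^bsub>?T\<^esub> ?l u' t"
    if "u \<in> carrier U" "u' \<in> carrier U" "t \<in> carrier (tensor K V W)" for u u' t
    by (rule VW.tensor_linear_map_eq[OF lin linear_map_add[OF lin lin]])
      (simp_all add: that pure b)
  have smult: "?l (a \<odot>\<^bsub>U\<^esub> u) t = a \<odot>\<^bsub>?T\<^esub> ?l u t"
    if "a \<in> carrier K" "u \<in> carrier U" "t \<in> carrier (tensor K V W)" for a u t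
    by (rule VW.tensor_linear_map_eq[OF lin linear_map_comp[OF lin T.linear_map_smult]])
      (simp_all add: that pure b)
  note l = UV_W.tensor_vectorspace closed add smult linear_map.T_add[OF lin]
    linear_map.T_smult[OF lin]
  show "linear_map K (tensor K U (tensor K V W)) ?T (tensor_assoc K U V W)"
    unfolding tensor_assoc_def by (rule U_VW.tensor_lift_linear) (simp_all add: l)
  show "tensor_assoc K U V W (pure_tensor K U (tensor K V W) u (pure_tensor K V W v w)) =
      ?b u v w"
    if "u \<in> carrier U" "v \<in> carrier V" "w \<in> carrier W"
    unfolding tensor_assoc_def
    by (subst U_VW.tensor_lift_pure) (simp_all add: l that pure VW.pure_closed)
qed

section \<open>Rota-Baxter coalgebras of weight -1\<close>

locale rota_baxter_weight_minus_one =
  hom_coassociative_rota_baxter_coalgebra K C \<Delta> \<alpha> R "\<ominus>\<^bsub>K\<^esub> \<one>\<^bsub>K\<^esub>"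
  for K :: "('k, 'm) ring_scheme" and C :: "('k, 'c, 'n) module_scheme" and \<Delta> \<alpha> R
begin

section \<open>Operators on the second and third tensor powers of C\<close>

abbreviation "T2 \<equiv> tensor K C C"
abbreviation "T3 \<equiv> tensor K T2 C"
abbreviation pure2 (infixl "\<otimes>\<^sub>2" 70) where "x \<otimes>\<^sub>2 y \<equiv> pure_tensor K C C x y"
abbreviation pure3 (infixl "\<otimes>\<^sub>3" 70) where "s \<otimes>\<^sub>3 z \<equiv> pure_tensor K T2 C s z"
abbreviation "flip \<equiv> tensor_flip K C C"
abbreviation "flip12 \<equiv> tensor_map K T2 C flip id"
abbreviation "R1 \<equiv> tensor_map K C C R id"
abbreviation "R2 \<equiv> tensor_map K C C id R"
abbreviation "R12 \<equiv> tensor_map K C C R R"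
abbreviation "S1 \<equiv> tensor_map K T2 C R1 id"
abbreviation "S2 \<equiv> tensor_map K T2 C R2 id"
abbreviation "assoc \<equiv> tensor_assoc K C C C"

text \<open>\<open>rot\<close> takes \<open>x \<otimes> y \<otimes> z\<close> to \<open>z \<otimes> x \<otimes> y\<close>; every other permutation is made from it and \<open>flip12\<close>.\<close>

definition rot where "rot t = assoc (tensor_flip K T2 C t)"
text \<open>Since \<open>rot\<close> has order three, \<open>rot\<close> applied twice is its
  inverse, and this is \<open>flip12\<close> conjugated by \<open>rot\<close>.\<close>

definition flip23 where "flip23 t = rot (flip12 (rot (rot t)))"

sublocale CC: tensor_spaces K C C
  by (intro tensor_spaces.intro vectorspace_axioms)
sublocale T2: vectorspace K T2 by (rule CC.tensor_vectorspace)
sublocale CT: tensor_spaces K C T2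
  by (intro tensor_spaces.intro vectorspace_axioms T2.vectorspace_axioms)
sublocale TC: tensor_spaces K T2 C
  by (intro tensor_spaces.intro vectorspace_axioms T2.vectorspace_axioms)
sublocale T3: vectorspace K T3 by (rule TC.tensor_vectorspace)

lemma id_linear: "linear_map K C C id" "linear_map K T2 T2 id"
  using linear_map_id T2.linear_map_id unfolding id_def by auto

lemmas basic_linear = id_linear rota_baxter_linear twist_linear comult_linear
  tensor_flip_linear[OF vectorspace_axioms vectorspace_axioms]

sublocale R: linear_map K C C R by (rule basic_linear)
sublocale \<alpha>: linear_map K C C \<alpha> by (rule basic_linear)
sublocale \<Delta>: linear_map K C T2 \<Delta> by (rule basic_linear)
sublocale flip: linear_map K T2 T2 flip by (rule basic_linear)
sublocale R1: linear_map K T2 T2 R1 by (intro tensor_map_linear basic_linear)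
sublocale R2: linear_map K T2 T2 R2 by (intro tensor_map_linear basic_linear)
sublocale R12: linear_map K T2 T2 R12 by (intro tensor_map_linear basic_linear)
sublocale flip12: linear_map K T3 T3 flip12 by (intro tensor_map_linear basic_linear)
sublocale S1: linear_map K T3 T3 S1 by (intro tensor_map_linear basic_linear)
sublocale S2: linear_map K T3 T3 S2 by (intro tensor_map_linear basic_linear)
sublocale assoc: linear_map K "tensor K C T2" T3 assoc
  by (intro tensor_assoc_linear vectorspace_axioms)
sublocale rot: linear_map K T3 T3 rot
  unfolding rot_def
  by (rule linear_map_comp[OF tensor_flip_linear assoc.linear_map_axioms])
    (intro vectorspace_axioms T2.vectorspace_axioms)+

text \<open>These rules evaluate the operators on pure tensors. Where possible \<open>s\<close>
  stays an arbitrary element of \<open>T2\<close>, because values of \<Delta> are substituted for it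
  later.\<close>

lemma pure_simps [simp]:
  "\<lbrakk>x \<in> carrier C; y \<in> carrier C\<rbrakk> \<Longrightarrow> x \<otimes>\<^sub>2 y \<in> carrier T2"
  "\<lbrakk>s \<in> carrier T2; z \<in> carrier C\<rbrakk> \<Longrightarrow> s \<otimes>\<^sub>3 z \<in> carrier T3"
  "\<lbrakk>z \<in> carrier C; s \<in> carrier T2\<rbrakk> \<Longrightarrow> pure_tensor K C T2 z s \<in> carrier (tensor K C T2)"
  "\<lbrakk>x \<in> carrier C; y \<in> carrier C\<rbrakk> \<Longrightarrow> flip (x \<otimes>\<^sub>2 y) = y \<otimes>\<^sub>2 x"
  "\<lbrakk>x \<in> carrier C; y \<in> carrier C\<rbrakk> \<Longrightarrow> R1 (x \<otimes>\<^sub>2 y) = R x \<otimes>\<^sub>2 y"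
  "\<lbrakk>x \<in> carrier C; y \<in> carrier C\<rbrakk> \<Longrightarrow> R2 (x \<otimes>\<^sub>2 y) = x \<otimes>\<^sub>2 R y"
  "\<lbrakk>x \<in> carrier C; y \<in> carrier C\<rbrakk> \<Longrightarrow> R12 (x \<otimes>\<^sub>2 y) = R x \<otimes>\<^sub>2 R y"
  "\<lbrakk>s \<in> carrier T2; z \<in> carrier C\<rbrakk> \<Longrightarrow> flip12 (s \<otimes>\<^sub>3 z) = flip s \<otimes>\<^sub>3 z"
  "\<lbrakk>s \<in> carrier T2; z \<in> carrier C\<rbrakk> \<Longrightarrow> S1 (s \<otimes>\<^sub>3 z) = R1 s \<otimes>\<^sub>3 z"
  "\<lbrakk>s \<in> carrier T2; z \<in> carrier C\<rbrakk> \<Longrightarrow> S2 (s \<otimes>\<^sub>3 z) = R2 s \<otimes>\<^sub>3 z"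
  "\<lbrakk>s \<in> carrier T2; z \<in> carrier C\<rbrakk> \<Longrightarrow> rot (s \<otimes>\<^sub>3 z) = assoc (pure_tensor K C T2 z s)"
  "\<lbrakk>x \<in> carrier C; y \<in> carrier C; z \<in> carrier C\<rbrakk> \<Longrightarrow>
    assoc (pure_tensor K C T2 x (y \<otimes>\<^sub>2 z)) = x \<otimes>\<^sub>2 y \<otimes>\<^sub>3 z"
  by (simp_all add: CC.pure_closed TC.pure_closed CT.pure_closed rot_def
    tensor_map_pure[OF id_linear(1) rota_baxter_linear]
    tensor_map_pure[OF rota_baxter_linear rota_baxter_linear]
    tensor_map_pure[OF rota_baxter_linear id_linear(1)]
    tensor_map_pure[OF flip.linear_map_axioms id_linear(1)]
    tensor_map_pure[OF R1.linear_map_axioms id_linear(1)]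
    tensor_map_pure[OF R2.linear_map_axioms id_linear(1)]
    tensor_flip_pure[OF vectorspace_axioms vectorspace_axioms]
    tensor_flip_pure[OF T2.vectorspace_axioms vectorspace_axioms]
    tensor_assoc_pure[OF vectorspace_axioms vectorspace_axioms vectorspace_axioms])

text \<open>With the factor \<open>z\<close> fixed, an identity in the threefold product becomes
  linear in \<open>s\<close>, so that uniqueness on \<open>T2\<close> applies.\<close>

lemma pure_tensor_linear:
  assumes "z \<in> carrier C"
  shows "linear_map K T2 T3 (\<lambda>s. s \<otimes>\<^sub>3 z)" "linear_map K T2 T3 (\<lambda>s. assoc (pure_tensor K C T2 z s))"
  using assms
  by (intro linear_mapI T2.vectorspace_axioms T3.vectorspace_axioms;
    simp add: CC.pure_bilinear CT.pure_bilinear TC.pure_bilinear)+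

lemmas pure_minus = linear_map.T_minus[OF pure_tensor_linear(1)]
  linear_map.T_minus[OF pure_tensor_linear(2)]

text \<open>Uniqueness is used twice: once to split off the last factor, once to split the remaining
  element of \<open>T2\<close>.\<close>

lemma T3_eqI:
  assumes f: "linear_map K T3 U f" and g: "linear_map K T3 U g"
    and pure: "\<And>x y z. \<lbrakk>x \<in> carrier C; y \<in> carrier C; z \<in> carrier C\<rbrakk> \<Longrightarrow>
      f (x \<otimes>\<^sub>2 y \<otimes>\<^sub>3 z) = g (x \<otimes>\<^sub>2 y \<otimes>\<^sub>3 z)"
    and A: "A \<in> carrier T3"
  shows "f A = g A"
proof (rule TC.tensor_linear_map_eq[OF f g _ A])
  fix s z assume s: "s \<in> carrier T2" and z: "z \<in> carrier C"
  show "f (s \<otimes>\<^sub>3 z) = g (s \<otimes>\<^sub>3 z)"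
    by (rule CC.tensor_linear_map_eq[OF linear_map_comp[OF pure_tensor_linear(1)[OF z] f]
      linear_map_comp[OF pure_tensor_linear(1)[OF z] g] _ s]) (simp add: pure z)
qed

text \<open>The argument is \<open>s \<otimes>\<^sub>3 z\<close> after one turn of the 3-cycle, and
  two more turns bring it back.\<close>

lemma rot_rot_assoc [simp]:
  assumes z: "z \<in> carrier C" and s: "s \<in> carrier T2"
  shows "rot (rot (assoc (pure_tensor K C T2 z s))) = s \<otimes>\<^sub>3 z"
  by (rule CC.tensor_linear_map_eq[OF linear_map_comp[OF linear_map_comp[OF pure_tensor_linear(2)[OF z]
    rot.linear_map_axioms] rot.linear_map_axioms] pure_tensor_linear(1)[OF z] _ s]) (simp add: z)

lemma S1_assoc [simp]:
  assumes z: "z \<in> carrier C" and s: "s \<in> carrier T2"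
  shows "S1 (assoc (pure_tensor K C T2 z s)) = assoc (pure_tensor K C T2 (R z) s)"
  by (rule CC.tensor_linear_map_eq[OF linear_map_comp[OF pure_tensor_linear(2)[OF z]
    S1.linear_map_axioms] pure_tensor_linear(2)[OF R.T_im[OF z]] _ s]) (simp add: z)

lemma R1_R2 [simp]:
  assumes s: "s \<in> carrier T2"
  shows "R1 (R2 s) = R12 s"
  by (rule CC.tensor_linear_map_eq[OF linear_map_comp[OF R2.linear_map_axioms
    R1.linear_map_axioms] R12.linear_map_axioms _ s]) simp

section \<open>Antisymmetrization and the operator producing the new coproduct\<close>

definition anti where "anti s = s \<ominus>\<^bsub>T2\<^esub> flip s"
definition anti12 where "anti12 A = A \<ominus>\<^bsub>T3\<^esub> flip12 A"
definition twisted where "twisted s = R1 s \<ominus>\<^bsub>T2\<^esub> flip (R2 s) \<ominus>\<^bsub>T2\<^esub> s"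
text \<open>This is I \<otimes> \<open>twisted\<close>. Applying R to the third factor and then
  swapping equals swapping and then applying R to the second factor, hence \<open>S2\<close> after
  \<open>flip23\<close>.\<close>

definition twisted23 where "twisted23 A = S2 A \<ominus>\<^bsub>T3\<^esub> S2 (flip23 A) \<ominus>\<^bsub>T3\<^esub> A"

sublocale anti: linear_map K T2 T2 anti
  unfolding anti_def
  by (intro linear_map_diff T2.linear_map_id flip.linear_map_axioms)

sublocale anti12: linear_map K T3 T3 anti12
  unfolding anti12_def
  by (intro linear_map_diff T3.linear_map_id flip12.linear_map_axioms)

sublocale twisted: linear_map K T2 T2 twisted
  unfolding twisted_def
  by (intro linear_map_diff T2.linear_map_id R1.linear_map_axioms
    linear_map_comp[OF R2.linear_map_axioms flip.linear_map_axioms])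

sublocale flip23: linear_map K T3 T3 flip23
  unfolding flip23_def
  by (intro linear_map_comp[OF _ rot.linear_map_axioms] linear_map_comp[OF _ flip12.linear_map_axioms]
    rot.linear_map_axioms)

sublocale twisted23: linear_map K T3 T3 twisted23
  unfolding twisted23_def
  by (intro linear_map_diff T3.linear_map_id S2.linear_map_axioms
    linear_map_comp[OF flip23.linear_map_axioms S2.linear_map_axioms])

lemma twisted_comult: "rota_baxter_comult K C \<Delta> R c = twisted (\<Delta> c)"
  by (simp add: rota_baxter_comult_def twisted_def)

lemma anti12_pure [simp]: "\<lbrakk>s \<in> carrier T2; z \<in> carrier C\<rbrakk> \<Longrightarrow> anti12 (s \<otimes>\<^sub>3 z) = anti s \<otimes>\<^sub>3 z"
  by (simp add: anti_def anti12_def pure_minus)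

lemma flip23_pure [simp]:
  "\<lbrakk>x \<in> carrier C; y \<in> carrier C; z \<in> carrier C\<rbrakk> \<Longrightarrow>
    flip23 (x \<otimes>\<^sub>2 y \<otimes>\<^sub>3 z) = x \<otimes>\<^sub>2 z \<otimes>\<^sub>3 y"
  by (simp add: flip23_def)

lemma assoc_twisted:
  assumes z: "z \<in> carrier C" and s: "s \<in> carrier T2"
  shows "assoc (pure_tensor K C T2 z (twisted s)) = twisted23 (assoc (pure_tensor K C T2 z s))"
  by (rule CC.tensor_linear_map_eq[OF
      linear_map_comp[OF twisted.linear_map_axioms pure_tensor_linear(2)[OF z]]
      linear_map_comp[OF pure_tensor_linear(2)[OF z] twisted23.linear_map_axioms] _ s])
    (simp add: z twisted_def twisted23_def pure_minus)

text \<open>Up to sign, the two arguments of \<open>anti\<close> differ by \<open>R2 s\<close> plus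
  its flip, which is symmetric and so is killed. This is dual to x * y - y * x = {x, y} - {y,
  x}.\<close>

lemma anti_twisted:
  assumes s: "s \<in> carrier T2"
  shows "anti (twisted s) = anti (R1 s \<oplus>\<^bsub>T2\<^esub> R2 s \<ominus>\<^bsub>T2\<^esub> s)"
proof -
  have "linear_map K T2 T2 (\<lambda>s. R1 s \<oplus>\<^bsub>T2\<^esub> R2 s \<ominus>\<^bsub>T2\<^esub> s)"
    by (intro linear_map_diff linear_map_add T2.linear_map_id R1.linear_map_axioms
        R2.linear_map_axioms)
  note linear = linear_map_comp[OF twisted.linear_map_axioms anti.linear_map_axioms]
    linear_map_comp[OF this anti.linear_map_axioms]
  show ?thesis
    by (rule CC.tensor_linear_map_eq[OF linear _ s])
      (simp add: anti_def twisted_def a_minus_def T2.M.minus_add T2.M.a_ac)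
qed

text \<open>The Rota-Baxter identity enters here: for weight -1 the sum in
  \<open>anti_twisted\<close>, taken at \<Delta> (R x), is exactly
  \<open>R12 (\<Delta> x)\<close>.\<close>

lemma anti_twisted_R:
  assumes x: "x \<in> carrier C"
  shows "anti (twisted (\<Delta> (R x))) = anti (R12 (\<Delta> x))"
  using x by (simp add: anti_twisted rota_baxter a_minus_def T2.smult_minus_1 T2.smult_l_minus)

lemma twisted_pure [simp]:
  "\<lbrakk>x \<in> carrier C; y \<in> carrier C\<rbrakk> \<Longrightarrow>
    twisted (x \<otimes>\<^sub>2 y) = R x \<otimes>\<^sub>2 y \<ominus>\<^bsub>T2\<^esub> R y \<otimes>\<^sub>2 x \<ominus>\<^bsub>T2\<^esub> x \<otimes>\<^sub>2 y"
  by (simp add: twisted_def)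

lemmas twisted_comult_linear = linear_map_comp[OF comult_linear twisted.linear_map_axioms]

section \<open>Threefold comultiplications of the new coproduct in terms of the old one\<close>

abbreviation "left \<equiv> tensor_map K T2 C \<Delta> \<alpha>"
abbreviation "right t \<equiv> assoc (tensor_map K C T2 \<alpha> \<Delta> t)"
abbreviation "left' \<equiv> tensor_map K T2 C (\<lambda>c. twisted (\<Delta> c)) \<alpha>"
abbreviation "right' t \<equiv> assoc (tensor_map K C T2 \<alpha> (\<lambda>c. twisted (\<Delta> c)) t)"

sublocale left: linear_map K T2 T3 left
  by (rule tensor_map_linear[OF comult_linear twist_linear])
sublocale left': linear_map K T2 T3 left'
  by (rule tensor_map_linear[OF twisted_comult_linear twist_linear])
sublocale right: linear_map K T2 T3 right
  by (rule linear_map_comp[OF tensor_map_linear[OF twist_linear comult_linear] assoc.linear_map_axioms])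
sublocale right': linear_map K T2 T3 right'
  by (rule linear_map_comp[OF tensor_map_linear[OF twist_linear twisted_comult_linear] assoc.linear_map_axioms])

lemmas left_right_pure = tensor_map_pure[OF comult_linear twist_linear]
  tensor_map_pure[OF twisted_comult_linear twist_linear]
  tensor_map_pure[OF twist_linear comult_linear]
  tensor_map_pure[OF twist_linear twisted_comult_linear]

text \<open>For \<open>t = x \<otimes>\<^sub>2 y\<close>, the terms of \<open>twisted t\<close>
  containing R x and R y give \<open>R12 (\<Delta> x) \<otimes>\<^sub>3 \<alpha> y\<close> and
  \<open>R12 (\<Delta> y) \<otimes>\<^sub>3 \<alpha> x\<close> under \<open>anti12\<close>. In the
  second, \<Delta> y \<otimes> \<alpha> x is \<open>rot (rot (right t))\<close>.\<close>

lemma antisymmetrized_left: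
  assumes t: "t \<in> carrier T2"
  shows "anti12 (left' (twisted t)) =
    anti12 (S1 (S2 (left t)) \<ominus>\<^bsub>T3\<^esub> S1 (S2 (rot (rot (right t))))
      \<ominus>\<^bsub>T3\<^esub> (S1 (left t) \<oplus>\<^bsub>T3\<^esub> S2 (left t) \<ominus>\<^bsub>T3\<^esub> left t))"
proof -
  note S12 = linear_map_comp[OF S2.linear_map_axioms S1.linear_map_axioms]
  have "linear_map K T2 T3 (\<lambda>t. S1 (S2 (left t)) \<ominus>\<^bsub>T3\<^esub> S1 (S2 (rot (rot (right t))))
      \<ominus>\<^bsub>T3\<^esub> (S1 (left t) \<oplus>\<^bsub>T3\<^esub> S2 (left t) \<ominus>\<^bsub>T3\<^esub> left t))"
    by (intro linear_map_diff linear_map_add left.linear_map_axioms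
        linear_map_comp[OF left.linear_map_axioms S1.linear_map_axioms]
        linear_map_comp[OF left.linear_map_axioms S2.linear_map_axioms]
        linear_map_comp[OF left.linear_map_axioms S12]
        linear_map_comp[OF linear_map_comp[OF linear_map_comp[OF right.linear_map_axioms
          rot.linear_map_axioms] rot.linear_map_axioms] S12])
  note linear = linear_map_comp[OF linear_map_comp[OF twisted.linear_map_axioms
      left'.linear_map_axioms] anti12.linear_map_axioms]
    linear_map_comp[OF this anti12.linear_map_axioms]
  show ?thesis
    \<comment> \<open>The Rota-Baxter rule goes first, because \<open>anti_twisted\<close> would
      also rewrite the terms with \<Delta> (R x); the second pass treats the term without R.\<close>
    by (rule CC.tensor_linear_map_eq[OF linear _ t], simp add: left_right_pure anti_twisted_R)
      (simp add: anti_twisted pure_minus TC.pure_bilinear)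
qed

text \<open>Here R meets only \<alpha>, with which it commutes, so it moves out as
  \<open>S1\<close>. For \<open>t = x \<otimes>\<^sub>2 y\<close>, the swapped term \<alpha> y
  \<otimes> \<Delta> x is \<open>rot (left t)\<close>.\<close>

lemma twisted_right:
  assumes t: "t \<in> carrier T2"
  shows "right' (twisted t) =
    twisted23 (S1 (right t) \<ominus>\<^bsub>T3\<^esub> S1 (rot (left t)) \<ominus>\<^bsub>T3\<^esub> right t)"
proof -
  have "linear_map K T2 T3 (\<lambda>t. S1 (right t) \<ominus>\<^bsub>T3\<^esub> S1 (rot (left t)) \<ominus>\<^bsub>T3\<^esub> right t)"
    by (intro linear_map_diff right.linear_map_axioms
        linear_map_comp[OF right.linear_map_axioms S1.linear_map_axioms]
        linear_map_comp[OF linear_map_comp[OF left.linear_map_axioms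
          rot.linear_map_axioms] S1.linear_map_axioms])
  note linear = linear_map_comp[OF twisted.linear_map_axioms right'.linear_map_axioms]
    linear_map_comp[OF this twisted23.linear_map_axioms]
  show ?thesis
    by (rule CC.tensor_linear_map_eq[OF linear _ t])
      (simp add: left_right_pure assoc_twisted rota_baxter_twist)
qed

section \<open>Comparison of the two sides as operators on one element\<close>

lemma flip12_flip12:
  assumes A: "A \<in> carrier T3"
  shows "flip12 (flip12 A) = A"
  by (rule T3_eqI[OF linear_map_comp[OF flip12.linear_map_axioms flip12.linear_map_axioms]
      T3.linear_map_id _ A]) simp

lemma anti12_flip12: "A \<in> carrier T3 \<Longrightarrow> anti12 (flip12 A) = \<ominus>\<^bsub>T3\<^esub> anti12 A"
  by (simp add: anti12_def flip12_flip12 a_minus_def T3.M.minus_add T3.M.a_comm)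

text \<open>
  Every summand but \<open>flip12 (S1 (S2 (rot (rot A))))\<close> either occurs in \<open>antisymmetrized_left\<close> or is
  symmetric in the first two factors; \<open>anti12\<close> kills the
  symmetric ones and changes the sign of that summand.
\<close>

lemma twisted23_eq:
  assumes A: "A \<in> carrier T3"
  shows "twisted23 (S1 A \<ominus>\<^bsub>T3\<^esub> S1 (rot A) \<ominus>\<^bsub>T3\<^esub> A) =
    S1 (S2 A) \<oplus>\<^bsub>T3\<^esub> flip12 (S1 (S2 (rot (rot A)))) \<ominus>\<^bsub>T3\<^esub> (S1 A \<oplus>\<^bsub>T3\<^esub> S2 A \<ominus>\<^bsub>T3\<^esub> A) \<ominus>\<^bsub>T3\<^esub>
    (S1 (S2 (rot A)) \<oplus>\<^bsub>T3\<^esub> flip12 (S1 (S2 (rot A)))) \<oplus>\<^bsub>T3\<^esub> (S1 (rot A) \<oplus>\<^bsub>T3\<^esub> flip12 (S1 (rot A)))"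
proof -
  note S12 = linear_map_comp[OF S2.linear_map_axioms S1.linear_map_axioms]
  note rot_S12 = linear_map_comp[OF rot.linear_map_axioms S12]
  note rot_rot_S12 = linear_map_comp[OF rot.linear_map_axioms rot_S12]
  note rot_S1 = linear_map_comp[OF rot.linear_map_axioms S1.linear_map_axioms]
  note intros = linear_map_diff linear_map_add T3.linear_map_id S1.linear_map_axioms
    S2.linear_map_axioms S12 rot_S1 rot_S12 linear_map_comp[OF rot_S1 flip12.linear_map_axioms]
    linear_map_comp[OF rot_S12 flip12.linear_map_axioms]
    linear_map_comp[OF rot_rot_S12 flip12.linear_map_axioms]
  have 1: "linear_map K T3 T3 (\<lambda>A. S1 A \<ominus>\<^bsub>T3\<^esub> S1 (rot A) \<ominus>\<^bsub>T3\<^esub> A)"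
    by (intro intros)
  have 2: "linear_map K T3 T3 (\<lambda>A. S1 (S2 A) \<oplus>\<^bsub>T3\<^esub> flip12 (S1 (S2 (rot (rot A)))) \<ominus>\<^bsub>T3\<^esub>
    (S1 A \<oplus>\<^bsub>T3\<^esub> S2 A \<ominus>\<^bsub>T3\<^esub> A) \<ominus>\<^bsub>T3\<^esub> (S1 (S2 (rot A)) \<oplus>\<^bsub>T3\<^esub> flip12 (S1 (S2 (rot A)))) \<oplus>\<^bsub>T3\<^esub>
    (S1 (rot A) \<oplus>\<^bsub>T3\<^esub> flip12 (S1 (rot A))))"
    by (intro intros)
  show ?thesis
    \<comment> \<open>On a pure tensor both sides expand to the same nine signed terms.\<close>
    by (rule T3_eqI[OF linear_map_comp[OF 1 twisted23.linear_map_axioms] 2 _ A])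
      (simp add: twisted23_def a_minus_def T3.M.minus_add T3.M.a_ac)
qed

lemma antisymmetrized_eq:
  assumes A: "A \<in> carrier T3"
  shows "anti12 (S1 (S2 A) \<ominus>\<^bsub>T3\<^esub> S1 (S2 (rot (rot A))) \<ominus>\<^bsub>T3\<^esub> (S1 A \<oplus>\<^bsub>T3\<^esub> S2 A \<ominus>\<^bsub>T3\<^esub> A)) =
    anti12 (twisted23 (S1 A \<ominus>\<^bsub>T3\<^esub> S1 (rot A) \<ominus>\<^bsub>T3\<^esub> A))"
  unfolding twisted23_eq[OF A]
  using A
  \<comment> \<open>The first pass distributes \<open>anti12\<close> and cancels each symmetric
    pair; the second arranges the remaining signs.\<close>
  by (simp add: anti12_flip12 T3.M.r_neg) (simp add: a_minus_def T3.M.minus_add T3.M.a_ac)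

lemma preLie: "hom_preLie_coalgebra K C (rota_baxter_comult K C \<Delta> R) \<alpha>"
proof -
  have eq: "rota_baxter_comult K C \<Delta> R = (\<lambda>c. twisted (\<Delta> c))"
    by (rule ext) (rule twisted_comult)
  interpret P: hom_coalgebra_data K C "\<lambda>c. twisted (\<Delta> c)" \<alpha>
    by (intro hom_coalgebra_data.intro hom_coalgebra_data_axioms.intro vectorspace_axioms
      twisted_comult_linear twist_linear)
  show ?thesis unfolding eq
  proof (intro hom_preLie_coalgebra.intro hom_preLie_coalgebra_axioms.intro P.hom_coalgebra_data_axioms)
    fix c assume c: "c \<in> carrier C"
    let ?A = "left (\<Delta> c)"
    \<comment> \<open>Hom-coassociativity makes both antisymmetrized sides operators applied to the
      single element \<open>?A\<close>, as \<open>antisymmetrized_eq\<close> requires.\<close>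
    have A: "right (\<Delta> c) = ?A"
      using hom_coassociative[OF c] unfolding comult_left_def comult_right_def .
    let ?l = "left' (twisted (\<Delta> c))" and ?r = "right' (twisted (\<Delta> c))"
    have coassociator: "P.coassociator c = ?l \<ominus>\<^bsub>T3\<^esub> ?r"
      by (simp only: P.coassociator_def P.comult_left_def P.comult_right_def)
    have t: "\<Delta> c \<in> carrier T2" "?A \<in> carrier T3" "?l \<in> carrier T3" "?r \<in> carrier T3"
      using c by simp_all
    have "anti12 ?l = anti12 ?r"
      by (simp only: antisymmetrized_left[OF t(1)] twisted_right[OF t(1)] A
        antisymmetrized_eq[OF t(2)])
    \<comment> \<open>Vanishing of \<open>anti12\<close> on the coassociator is its invariance under
      \<open>flip12\<close>, which is the Hom-preLie identity.\<close>
    then have "anti12 (?l \<ominus>\<^bsub>T3\<^esub> ?r) = \<zero>\<^bsub>T3\<^esub>"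
      by (simp only: anti12.T_minus[OF t(3,4)] T3.M.diff_eq_zero_iff anti12.T_im[OF t(4)])
    then show "P.coassociator c = flip12 (P.coassociator c)"
      unfolding coassociator anti12_def
      by (simp only: T3.M.diff_eq_zero_iff T3.M.minus_closed[OF t(3,4)] flip12.T_im)
  qed
qed

end

theorem proposition3p15:
  fixes K :: "('k, 'm) ring_scheme" and C :: "('k, 'c, 'n) module_scheme"
    and \<Delta>\<^sub>0 :: "'c \<Rightarrow> ('c \<times> 'c \<Rightarrow> 'k) set" and \<alpha> R :: "'c \<Rightarrow> 'c"
  assumes "char_zero K"
    and "hom_coassociative_rota_baxter_coalgebra K C \<Delta>\<^sub>0 \<alpha> R (\<ominus>\<^bsub>K\<^esub> \<one>\<^bsub>K\<^esub>)"
  shows "hom_preLie_coalgebra K C (rota_baxter_comult K C \<Delta>\<^sub>0 R) \<alpha>"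
  by (rule rota_baxter_weight_minus_one.preLie[OF rota_baxter_weight_minus_one.intro[OF assms(2)]])

end
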